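(* For every even integer $n\geq4$, $$p(n)\equiv\gamma(4)+\gamma(6)+\gamma(8)+\cdots+\gamma(n-2)+\gamma(n)\pmod2,$$ i.e. $p(n)\equiv\sum_{j=2}^{n/2}\gamma(2j)\pmod 2$.
   Context: $p(n)$ is the number of integer partitions of $n$. A nuclear partition is an integer partition with no part equal to $1$. $\gamma(n)$ denotes the number of nuclear partitions $\mu=(\mu_1,\mu_2,\dots,\mu_r)$ of $n$, with $\mu_1\geq\mu_2\geq\dots\geq\mu_r\geq2$ and $r\geq2$, such that $\mu_1=\mu_2$ (so the two largest parts are equal). *)

theory Defs
  imports "HOL-Number_Theory.Cong"
begin

definition partitions :: "nat \<Rightarrow> nat list set" where
  "partitions n = {\<mu>. sorted_wrt (\<ge>) \<mu> \<and> (\<forall>k\<in>set \<mu>. k \<ge> 1) \<and> sum_list \<mu> = n}"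

definition num_partitions :: "nat \<Rightarrow> nat" where
  "num_partitions n = card (partitions n)"

definition nuclear_partitions :: "nat \<Rightarrow> nat list set" where
  "nuclear_partitions n = {\<mu>\<in>partitions n. 1 \<notin> set \<mu>}"

(* The list index starts at 0: the paper's \<mu>_1 and \<mu>_2 are \<mu> ! 0 and \<mu> ! 1. *)
definition gamma :: "nat \<Rightarrow> nat" where
  "gamma n = card {\<mu>\<in>nuclear_partitions n. length \<mu> \<ge> 2 \<and> \<mu> ! 0 = \<mu> ! 1}"

(* Since card is 0 on infinite sets, the two counts above depend on this. *)
lemma finite_partitions: "finite (partitions n)"
proof (rule finite_subset)
  have "length \<mu> \<le> sum_list \<mu>" if "\<forall>k\<in>set \<mu>. k \<ge> 1" for \<mu> :: "nat list"
    using that by (induction \<mu>) auto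
  then show "partitions n \<subseteq> {\<mu>. set \<mu> \<subseteq> {..n} \<and> length \<mu> \<le> n}"
    by (auto simp: partitions_def member_le_sum_list)
  show "finite {\<mu>. set \<mu> \<subseteq> {..n} \<and> length \<mu> \<le> n}"
    by (rule finite_lists_length_le) simp
qed

end

(* Removing a part 1 gives p(n) - p(n - 1) = nu(n), the number of nuclear partitions of n; adding 1
   to the largest part maps the nuclear partitions of n - 1 bijectively to those nuclear partitions
   of n whose largest part is not repeated, so gamma(n) = nu(n) - nu(n - 1). Hence gamma is the
   second difference of p, which modulo 2 is p(n) + p(n - 2), and the sum telescopes down to
   p(2) = 2. *)
theory Submission
  imports Defs
begin

lemma finite_nuclear_partitions: "finite (nuclear_partitions n)"
  unfolding nuclear_partitions_def using finite_partitions by simp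

text \<open>Parts are listed in weakly decreasing order and are at least 1, so a part 1 forces the
  last entry to be 1; deleting that entry undoes the appending.\<close>

lemma partitions_containing_1:
  "{\<mu> \<in> partitions (Suc n). 1 \<in> set \<mu>} = (\<lambda>\<mu>. \<mu> @ [1]) ` partitions n" (is "?A = ?B")
proof
  show "?A \<subseteq> ?B"
  proof
    fix \<mu> assume \<mu>: "\<mu> \<in> ?A"
    then have "\<mu> \<noteq> []"
      by auto
    then obtain \<nu> x where \<nu>: "\<mu> = \<nu> @ [x]"
      by (metis rev_exhaust)
    with \<mu> have "x = 1"
      by (fastforce simp: partitions_def sorted_wrt_append)
    with \<mu> \<nu> have "\<nu> \<in> partitions n"
      by (auto simp: partitions_def sorted_wrt_append)
    with \<nu> \<open>x = 1\<close> show "\<mu> \<in> ?B"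
      by blast
  qed
  show "?B \<subseteq> ?A"
    by (auto simp: partitions_def sorted_wrt_append)
qed

lemma num_partitions_Suc:
  "num_partitions (Suc n) = card (nuclear_partitions (Suc n)) + num_partitions n"
proof -
  let ?A = "{\<mu> \<in> partitions (Suc n). 1 \<in> set \<mu>}"
  have "partitions (Suc n) = nuclear_partitions (Suc n) \<union> ?A"
    by (auto simp: nuclear_partitions_def)
  moreover have "nuclear_partitions (Suc n) \<inter> ?A = {}"
    by (auto simp: nuclear_partitions_def)
  moreover have "finite ?A"
    using finite_partitions by simp
  ultimately have "num_partitions (Suc n) = card (nuclear_partitions (Suc n)) + card ?A"
    unfolding num_partitions_def by (metis card_Un_disjoint finite_nuclear_partitions)
  also have "card ?A = num_partitions n"
    unfolding partitions_containing_1 num_partitions_def by (rule card_image) (simp add: inj_on_def)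
  finally show ?thesis .
qed

text \<open>Lowering the largest part by 1 inverts the map. The negated condition also admits the
  one-part partition of \<open>Suc n\<close>. The bound on \<open>n\<close> excludes the empty
  partition, where \<open>hd\<close> is unspecified, and \<open>n = 1\<close>, where
  \<open>[2]\<close> would have to come from \<open>[1]\<close>.\<close>

lemma nuclear_partitions_largest_unrepeated:
  assumes "n \<ge> 2"
  shows "{\<mu> \<in> nuclear_partitions (Suc n). \<not> (length \<mu> \<ge> 2 \<and> \<mu> ! 0 = \<mu> ! 1)} =
    (\<lambda>\<mu>. Suc (hd \<mu>) # tl \<mu>) ` nuclear_partitions n" (is "?A = ?f ` ?B")
proof
  show "?A \<subseteq> ?f ` ?B"
  proof
    fix \<mu> assume \<mu>: "\<mu> \<in> ?A"
    then obtain x \<nu> where x: "\<mu> = x # \<nu>"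
      by (cases \<mu>) (auto simp: nuclear_partitions_def partitions_def)
    \<comment> \<open>After lowering \<open>x\<close>, the first fact keeps the list free of 1 and
      the second keeps it sorted.\<close>
    have "x \<ge> 3 \<and> (\<forall>y\<in>set \<nu>. y < x)"
    proof (cases \<nu>)
      case Nil
      with \<mu> x assms show ?thesis
        by (auto simp: nuclear_partitions_def partitions_def)
    next
      case (Cons y \<rho>)
      with \<mu> x have "y < x" "y \<ge> 2" "\<forall>z\<in>set \<rho>. z \<le> y"
        by (auto simp: nuclear_partitions_def partitions_def)
      with Cons show ?thesis
        by auto
    qed
    with \<mu> x have "(x - 1) # \<nu> \<in> ?B" "\<mu> = ?f ((x - 1) # \<nu>)"
      by (auto simp: nuclear_partitions_def partitions_def)
    then show "\<mu> \<in> ?f ` ?B"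
      by blast
  qed
  show "?f ` ?B \<subseteq> ?A"
  proof
    fix \<mu> assume "\<mu> \<in> ?f ` ?B"
    then obtain \<nu> where \<nu>: "\<nu> \<in> ?B" "\<mu> = ?f \<nu>"
      by blast
    with assms obtain x \<rho> where "\<nu> = x # \<rho>"
      by (cases \<nu>) (auto simp: nuclear_partitions_def partitions_def)
    with \<nu> show "\<mu> \<in> ?A"
      \<comment> \<open>Either there is a single part, or the second part is at most
        \<open>x\<close>, hence differs from \<open>Suc x\<close>.\<close>
      by (cases \<rho>) (auto simp: nuclear_partitions_def partitions_def)
  qed
qed

lemma card_nuclear_partitions_Suc:
  assumes "n \<ge> 2"
  shows "card (nuclear_partitions (Suc n)) = gamma (Suc n) + card (nuclear_partitions n)"
proof -
  let ?rep = "\<lambda>\<mu> :: nat list. length \<mu> \<ge> 2 \<and> \<mu> ! 0 = \<mu> ! 1"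
  let ?N = "nuclear_partitions (Suc n)"
  have "?N = {\<mu> \<in> ?N. ?rep \<mu>} \<union> {\<mu> \<in> ?N. \<not> ?rep \<mu>}"
    by blast
  then have "card ?N = card ({\<mu> \<in> ?N. ?rep \<mu>} \<union> {\<mu> \<in> ?N. \<not> ?rep \<mu>})"
    by (rule arg_cong)
  also have "\<dots> = card {\<mu> \<in> ?N. ?rep \<mu>} + card {\<mu> \<in> ?N. \<not> ?rep \<mu>}"
    by (rule card_Un_disjoint) (use finite_nuclear_partitions in auto)
  also have "card {\<mu> \<in> ?N. \<not> ?rep \<mu>} = card (nuclear_partitions n)"
    unfolding nuclear_partitions_largest_unrepeated[OF assms]
  proof (rule card_image)
    \<comment> \<open>Injectivity rests on recovering a list from its head and tail, which requires
      it to be nonempty.\<close>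
    have "\<mu> \<noteq> []" if "\<mu> \<in> nuclear_partitions n" for \<mu>
      using that assms by (auto simp: nuclear_partitions_def partitions_def)
    then show "inj_on (\<lambda>\<mu>. Suc (hd \<mu>) # tl \<mu>) (nuclear_partitions n)"
      by (intro inj_onI) (simp add: list.expand)
  qed
  finally show ?thesis
    by (simp add: gamma_def)
qed

text \<open>Eliminates the nuclear counts at \<open>n + 1\<close> and \<open>n + 2\<close>. The
  additive form avoids truncated subtraction.\<close>

lemma gamma_second_difference:
  assumes "n \<ge> 1"
  shows "gamma (n + 2) + 2 * num_partitions (n + 1) = num_partitions (n + 2) + num_partitions n"
  using num_partitions_Suc[of n] num_partitions_Suc[of "Suc n"]
    card_nuclear_partitions_Suc[of "Suc n"] assms
  by simp

lemma partitions_2: "partitions 2 = {[2], [1, 1]}"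
proof
  show "partitions 2 \<subseteq> {[2], [1, 1]}"
  proof
    fix \<mu> assume \<mu>: "\<mu> \<in> partitions 2"
    then obtain x \<nu> where x: "\<mu> = x # \<nu>"
      by (cases \<mu>) (auto simp: partitions_def)
    show "\<mu> \<in> {[2], [1, 1]}"
    proof (cases \<nu>)
      case Nil
      with \<mu> x show ?thesis
        by (auto simp: partitions_def)
    next
      case (Cons y \<rho>)
      with \<mu> x show ?thesis
        by (cases \<rho>) (auto simp: partitions_def)
    qed
  qed
qed (auto simp: partitions_def)

text \<open>Starting at \<open>m = 1\<close>, where the sum is empty, leaves only the evenness of
  p(2) to check as base case.\<close>

lemma num_partitions_even_cong:
  assumes "m \<ge> 1"
  shows "[num_partitions (2 * m) = (\<Sum>j=2..m. gamma (2 * j))] (mod 2)"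
  using assms
proof (induction m rule: dec_induct)
  case base
  show ?case
    by (simp add: num_partitions_def partitions_2 cong_def)
next
  case (step m)
  have "gamma (2 * Suc m) + 2 * num_partitions (2 * m + 1) =
      num_partitions (2 * Suc m) + num_partitions (2 * m)"
    using gamma_second_difference[of "2 * m"] step.hyps by simp
  moreover have "(\<Sum>j=2..Suc m. gamma (2 * j)) = (\<Sum>j=2..m. gamma (2 * j)) + gamma (2 * Suc m)"
    using step.hyps by simp
  \<comment> \<open>The term \<open>2 * num_partitions (2 * m + 1)\<close> vanishes modulo 2, and
    signs do not matter there.\<close>
  ultimately show ?case
    using step.IH unfolding cong_def by presburger
qed

theorem mainTheorem10:
  fixes n :: nat
  assumes "even n" and "n \<ge> 4"
  shows "[num_partitions n = (\<Sum>j=2..n div 2. gamma (2 * j))] (mod 2)"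
  using num_partitions_even_cong[of "n div 2"] assms by simp

end
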